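(* (Necessary conditions for optimality) Consider the gauge optimization problem (P) and its dual (D) defined in the context. Suppose that all elements of $d$ and $K$ are nonnegative and that the Slater constraint qualification holds for (P). Let $x^*$ and $(u^*,v^* )$ be optimal solutions of (P) and (D), respectively. Then the following conditions hold: (i) $Hx^*+K\mathcal{G}(x^* )\le p$, $Ax^*=b$, $x^*\in\mathrm{dom}\,\mathcal{G}$; (ii) $\mathcal{G}^\circ(A^Tu^*-H^Tv^*-c)-K^Tv^*\le d$, $v^*\ge 0$; (iii) $\left[d+K^Tv^*-\mathcal{G}^\circ(A^Tu^*-H^Tv^*-c)\right]_i\, g_i(x^*_{I_i})=0$ for $i=1,\dots,m$; (iv) $\left[p-Hx^*-K\mathcal{G}(x^* )\right]_i\, v_i^*=0$ for $i=1,\dots,\ell$; (v) $\mathcal{G}^\circ(A^Tu^*-H^Tv^*-c)^T\mathcal{G}(x^* )=(A^Tu^*-H^Tv^*-c)^Tx^*$.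
   Context: Vector inequalities are componentwise and $[\cdot]_i$ denotes the $i$-th component. The index set $\{1,\dots,n\}$ is partitioned into pairwise disjoint sets $I_1,\dots,I_m$ with $\#I_i=n_i$, $n=n_1+\cdots+n_m$; $x_{I_i}\in\mathbb{R}^{n_i}$ is the corresponding subvector of $x\in\mathbb{R}^n$. A gauge function is a function $g:\mathbb{R}^q\to\mathbb{R}\cup\{\infty\}$ that is convex, nonnegative, positively homogeneous ($g(\lambda x)=\lambda g(x)$ for all $x$ and $\lambda>0$) and satisfies $g(0)=0$. A vector gauge function is $\mathcal{G}(x)=(g_1(x_{I_1}),\dots,g_m(x_{I_m}))^T$ with each $g_i:\mathbb{R}^{n_i}\to\mathbb{R}\cup\{\infty\}$ a gauge function; $\mathrm{dom}\,\mathcal{G}=\{x : g_i(x_{I_i})<\infty,\ i=1,\dots,m\}$. The polar of $g_i$ is $g_i^\circ(y)=\sup\{x^Ty : g_i(x)\le 1\}$, and $\mathcal{G}^\circ(y)=(g_1^\circ(y_{I_1}),\dots,g_m^\circ(y_{I_m}))^T$. Given $c\in\mathbb{R}^n$, $d\in\mathbb{R}^m$, $b\in\mathbb{R}^k$, $p\in\mathbb{R}^\ell$, $A\in\mathbb{R}^{k\times n}$, $H\in\mathbb{R}^{\ell\times n}$, $K\in\mathbb{R}^{\ell\times m}$ and a vector gauge function $\mathcal{G}$: (P): minimize $c^Tx+d^T\mathcal{G}(x)$ subject to $Ax=b$, $Hx+K\mathcal{G}(x)\le p$, $x\in\mathrm{dom}\,\mathcal{G}$. (D): maximize $b^Tu-p^Tv$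 over $(u,v)\in\mathbb{R}^k\times\mathbb{R}^\ell$ subject to $\mathcal{G}^\circ(A^Tu-H^Tv-c)-K^Tv\le d$, $v\ge 0$. Slater constraint qualification for (P): there exists $\hat x$ in the relative interior of $\mathrm{dom}\,\mathcal{G}$ with $A\hat x=b$ and $H\hat x+K\mathcal{G}(\hat x)<p$ (strictly in every component). *)

theory Defs
  imports "HOL-Analysis.Analysis"
begin

text \<open>
  The index set of the variable is the type \<open>'n\<close>, that of the blocks is \<open>'m\<close>.  The space
  \<open>\<real>^J\<close> of subvectors with index set \<open>J\<close> is represented by the coordinate subspace
  \<open>coord_space J\<close> of \<^typ>\<open>real ^ 'n\<close>, so \<open>subvec J x\<close> pads with zeros.  A function on \<open>\<real>^J\<close> is
  constrained and used only on \<open>coord_space J\<close>; its values elsewhere are irrelevant.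
\<close>

definition coord_space :: "'n set \<Rightarrow> (real ^ 'n) set" where
  "coord_space J = {x. \<forall>j. j \<notin> J \<longrightarrow> x $ j = 0}"

definition subvec :: "'n set \<Rightarrow> real ^ 'n \<Rightarrow> real ^ 'n" where
  "subvec J x = (\<chi> j. if j \<in> J then x $ j else 0)"

text \<open>Nonnegativity excludes the value \<open>-\<infinity>\<close>.\<close>

definition gauge_fun_on :: "'a::real_vector set \<Rightarrow> ('a \<Rightarrow> ereal) \<Rightarrow> bool" where
  "gauge_fun_on S g \<longleftrightarrow>
     (\<forall>x\<in>S. \<forall>y\<in>S. \<forall>t. 0 < t \<and> t < 1 \<longrightarrow>
        g ((1 - t) *\<^sub>R x + t *\<^sub>R y) \<le> ereal (1 - t) * g x + ereal t * g y) \<and>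
     (\<forall>x\<in>S. 0 \<le> g x) \<and>
     (\<forall>x\<in>S. \<forall>c>0. g (c *\<^sub>R x) = ereal c * g x) \<and>
     g 0 = 0"

definition polar_on :: "'a::real_inner set \<Rightarrow> ('a \<Rightarrow> ereal) \<Rightarrow> 'a \<Rightarrow> ereal" where
  "polar_on S g y = Sup {ereal (x \<bullet> y) | x. x \<in> S \<and> g x \<le> 1}"

definition index_partition :: "('m \<Rightarrow> 'n set) \<Rightarrow> bool" where
  "index_partition I \<longleftrightarrow> disjoint_family I \<and> (\<Union>i. I i) = UNIV"

definition vector_gauge :: "('m \<Rightarrow> 'n set) \<Rightarrow> ('m \<Rightarrow> real ^ 'n \<Rightarrow> ereal) \<Rightarrow> bool" where
  "vector_gauge I g \<longleftrightarrow> index_partition I \<and> (\<forall>i. gauge_fun_on (coord_space (I i)) (g i))"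

definition vgauge ::
    "('m \<Rightarrow> 'n set) \<Rightarrow> ('m \<Rightarrow> real ^ 'n \<Rightarrow> ereal) \<Rightarrow> real ^ 'n \<Rightarrow> ereal ^ 'm" where
  "vgauge I g x = (\<chi> i. g i (subvec (I i) x))"

definition vgauge_dom ::
    "('m \<Rightarrow> 'n set) \<Rightarrow> ('m \<Rightarrow> real ^ 'n \<Rightarrow> ereal) \<Rightarrow> (real ^ 'n) set" where
  "vgauge_dom I g = {x. \<forall>i. g i (subvec (I i) x) < \<infinity>}"

definition vpolar ::
    "('m \<Rightarrow> 'n set) \<Rightarrow> ('m \<Rightarrow> real ^ 'n \<Rightarrow> ereal) \<Rightarrow> real ^ 'n \<Rightarrow> ereal ^ 'm" where
  "vpolar I g y = (\<chi> i. polar_on (coord_space (I i)) (g i) (subvec (I i) y))"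

text \<open>
  Extended-real counterparts of vector operations: \<^typ>\<open>ereal\<close> is not a semiring, so \<open>*v\<close> and
  \<open>\<bullet>\<close> do not apply to \<open>ereal ^ 'm\<close>.
\<close>

definition evec :: "real ^ 'm \<Rightarrow> ereal ^ 'm" where
  "evec x = (\<chi> i. ereal (x $ i))"

definition edot :: "ereal ^ 'm::finite \<Rightarrow> ereal ^ 'm \<Rightarrow> ereal" where
  "edot x y = (\<Sum>i\<in>UNIV. x $ i * y $ i)"

definition ematvec :: "real ^ 'm::finite ^ 'l \<Rightarrow> ereal ^ 'm \<Rightarrow> ereal ^ 'l" where
  "ematvec K z = (\<chi> r. edot (evec (K $ r)) z)"

definition primal_feasible where
  "primal_feasible I g (A :: real ^ 'n ^ 'k) b (H :: real ^ 'n ^ 'l) (K :: real ^ 'm ^ 'l) p x \<longleftrightarrow>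
     A *v x = b \<and>
     evec (H *v x) + ematvec K (vgauge I g x) \<le> evec p \<and>
     x \<in> vgauge_dom I g"

definition primal_objective where
  "primal_objective I g c d x = ereal (c \<bullet> x) + edot (evec d) (vgauge I g x)"

definition primal_optimal where
  "primal_optimal I g c d A b H K p x \<longleftrightarrow>
     is_arg_min (primal_objective I g c d) (primal_feasible I g A b H K p) x"

definition dual_feasible where
  "dual_feasible I g c d (A :: real ^ 'n ^ 'k) (H :: real ^ 'n ^ 'l) (K :: real ^ 'm ^ 'l) u v \<longleftrightarrow>
     vpolar I g (transpose A *v u - transpose H *v v - c) - evec (transpose K *v v) \<le> evec d \<and>
     0 \<le> v"

definition dual_optimal where
  "dual_optimal I g c d A b H K p u v \<longleftrightarrow>
     is_arg_max (\<lambda>(u, v). b \<bullet> u - p \<bullet> v) (\<lambda>(u, v). dual_feasible I g c d A H K u v) (u, v)"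

text \<open>
  The strict inequality is stated by components because \<open><\<close> on vectors means \<open>\<le>\<close> and not \<open>\<ge>\<close>.
\<close>

definition slater where
  "slater I g (A :: real ^ 'n ^ 'k) b (H :: real ^ 'n ^ 'l) (K :: real ^ 'm ^ 'l) p \<longleftrightarrow>
     (\<exists>x \<in> rel_interior (vgauge_dom I g).
        A *v x = b \<and>
        (\<forall>r. (evec (H *v x) + ematvec K (vgauge I g x)) $ r < evec p $ r))"

end

theory Submission
  imports Defs
begin

text \<open>
  Separating the origin from the convex set of pairs (objective excess, constraint values) by a
  hyperplane whose normal lies in the span of that set gives Lagrange multipliers; the Slater
  point makes the coefficient of the objective positive.  Since the Lagrangian is positively
  homogeneous up to a constant, being bounded below on the domain splits into nonnegativity of
  its homogeneous part, which is dual feasibility block by block, and an inequality for the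
  constant, which is absence of a duality gap.  The conditions (iii) to (v) are then the equality
  cases in the chain of inequalities proving weak duality.
\<close>

section \<open>Lagrange multipliers\<close>

text \<open>A convex combination of the witnesses \<open>x1\<close>, \<open>x2\<close> is again a
  witness: \<open>L x - b\<close> is affine, and the convexity bounds stay strict because some
  weight is positive.\<close>

lemma convex_strict_epigraph_image:
  fixes f :: "'a::real_vector \<Rightarrow> real" and h :: "'a \<Rightarrow> real ^ 'l::finite"
    and L :: "'a \<Rightarrow> 'e::real_vector"
  assumes f: "convex_on C f" and h: "\<And>r. convex_on C (\<lambda>x. h x $ r)" and L: "linear L"
  shows "convex {(t, y, w). \<exists>x\<in>C. f x < t \<and> y = L x - b \<and> (\<forall>r. h x $ r < w $ r)}"
    (is "convex ?M")
proof (rule convexI)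
  fix m1 m2 :: "real \<times> 'e \<times> (real ^ 'l)" and \<alpha> \<beta> :: real
  assume m: "m1 \<in> ?M" "m2 \<in> ?M" and ab: "0 \<le> \<alpha>" "0 \<le> \<beta>" "\<alpha> + \<beta> = 1"
  obtain t1 w1 x1 where 1: "m1 = (t1, L x1 - b, w1)" "x1 \<in> C" "f x1 < t1"
    "\<And>r. h x1 $ r < w1 $ r" using m(1) by auto
  obtain t2 w2 x2 where 2: "m2 = (t2, L x2 - b, w2)" "x2 \<in> C" "f x2 < t2"
    "\<And>r. h x2 $ r < w2 $ r" using m(2) by auto
  let ?x = "\<alpha> *\<^sub>R x1 + \<beta> *\<^sub>R x2"
  \<comment> \<open>Either weight may be zero; if \<open>\<alpha> = 0\<close>, then
    \<open>\<beta> = 1\<close> and strictness comes from the second pair.\<close>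
  have mix: "\<alpha> * s1 + \<beta> * s2 < \<alpha> * r1 + \<beta> * r2" if "s1 < r1" "s2 < r2" for s1 s2 r1 r2 :: real
  proof (cases "\<alpha> = 0")
    case False
    then have "\<alpha> * s1 < \<alpha> * r1" using that ab by simp
    moreover have "\<beta> * s2 \<le> \<beta> * r2" using that ab by (simp add: mult_left_mono)
    ultimately show ?thesis by simp
  qed (use that ab in auto)
  have C: "convex C" using f by (rule convex_on_imp_convex)
  have "?x \<in> C" using C 1(2) 2(2) ab by (simp add: convex_def)
  moreover have "f ?x < \<alpha> * t1 + \<beta> * t2"
    using f 1(2) 2(2) ab mix[OF 1(3) 2(3)] unfolding convex_on_def by fastforce
  moreover have "h ?x $ r < (\<alpha> *\<^sub>R w1 + \<beta> *\<^sub>R w2) $ r" for r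
    using h[of r] 1(2) 2(2) ab mix[OF 1(4) 2(4), of r r] unfolding convex_on_def by fastforce
  moreover have "\<alpha> *\<^sub>R (L x1 - b) + \<beta> *\<^sub>R (L x2 - b) = L ?x - b"
  proof -
    have "\<alpha> *\<^sub>R b + \<beta> *\<^sub>R b = b" using ab by (metis scaleR_left_distrib scaleR_one)
    moreover have "\<alpha> *\<^sub>R (L x1 - b) + \<beta> *\<^sub>R (L x2 - b)
        = (\<alpha> *\<^sub>R L x1 + \<beta> *\<^sub>R L x2) - (\<alpha> *\<^sub>R b + \<beta> *\<^sub>R b)"
      by (simp add: scaleR_right_diff_distrib)
    ultimately show ?thesis by (simp only: linear_add[OF L] linear_cmul[OF L])
  qed
  ultimately show "\<alpha> *\<^sub>R m1 + \<beta> *\<^sub>R m2 \<in> ?M"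
    unfolding 1(1) 2(1) by auto
qed

text \<open>The segment from \<open>x\<close> to \<open>z\<close> can be prolonged beyond
  \<open>z\<close> inside \<open>C\<close>. If \<open>\<phi>\<close> fell on the way from
  \<open>x\<close> to \<open>z\<close>, it would fall below its minimum there.\<close>

lemma linear_vanishes_if_nonneg_zero_rel_interior:
  fixes C :: "'a::euclidean_space set" and \<phi> :: "'a \<Rightarrow> real"
  assumes "convex C" and z: "z \<in> rel_interior C" and \<phi>: "linear \<phi>"
    and pos: "\<And>x. x \<in> C \<Longrightarrow> \<phi> z \<le> \<phi> x" and x: "x \<in> C"
  shows "\<phi> x = \<phi> z"
proof -
  obtain e where e: "e > 1" "(1 - e) *\<^sub>R x + e *\<^sub>R z \<in> C"
    using convex_rel_interior_if[OF \<open>convex C\<close> z] x hull_inc[of x C affine] by blast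
  have "\<phi> z \<le> (1 - e) * \<phi> x + e * \<phi> z"
    using pos[OF e(2)] by (simp add: linear_add[OF \<phi>] linear_cmul[OF \<phi>])
  then have "(e - 1) * (\<phi> x - \<phi> z) \<le> 0" by (simp add: algebra_simps)
  then have "\<phi> x \<le> \<phi> z" using e(1) by (simp add: mult_le_0_iff)
  with pos[OF x] show ?thesis by simp
qed

text \<open>The two halves of the Slater condition exclude a vanishing coefficient of the objective:
  the strict inequalities force \<open>v = 0\<close>, and then the relative interior forces the
  whole normal to vanish.\<close>

theorem slater_lagrange_multipliers:
  fixes f :: "'a::euclidean_space \<Rightarrow> real" and h :: "'a \<Rightarrow> real ^ 'l::finite"
    and L :: "'a \<Rightarrow> 'e::euclidean_space"
  assumes f: "convex_on C f" and h: "\<And>r. convex_on C (\<lambda>x. h x $ r)" and L: "linear L"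
    and z: "z \<in> rel_interior C" "L z = b" "\<And>r. h z $ r < 0"
    and opt: "\<And>x. x \<in> C \<Longrightarrow> L x = b \<Longrightarrow> (\<And>r. h x $ r \<le> 0) \<Longrightarrow> P \<le> f x"
  obtains u v where "\<And>r. 0 \<le> v $ r" "\<And>x. x \<in> C \<Longrightarrow> P \<le> f x + u \<bullet> (L x - b) + v \<bullet> h x"
proof -
  have C: "convex C" using f by (rule convex_on_imp_convex)
  have zC: "z \<in> C" using z(1) rel_interior_subset by blast
  define M where
    "M = {(t, y, w). \<exists>x\<in>C. f x - P < t \<and> y = L x - b \<and> (\<forall>r. h x $ r < w $ r)}"
  have MI: "(t, L x - b, w) \<in> M" if "x \<in> C" "f x - P < t" "\<And>r. h x $ r < w $ r" for t x w
    using that by (auto simp: M_def)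
  have "convex_on C (\<lambda>x. f x + - P)"
    by (intro convex_on_add f) (simp add: convex_on_const C)
  then have "convex M"
    using convex_strict_epigraph_image[OF _ h L, of "\<lambda>x. f x - P" b] by (simp add: M_def)
  have "(f z - P + 1, L z - b, h z + 1) \<in> M"
    using zC by (intro MI) auto
  then have "M \<noteq> {}" by blast
  \<comment> \<open>A witness for the origin would be a feasible point with value below
    \<open>P\<close>.\<close>
  have "0 \<notin> M"
    using opt by (force simp: M_def zero_prod_def less_imp_le)
  then obtain a where a: "a \<in> span M" "a \<noteq> 0" "\<And>x. x \<in> M \<Longrightarrow> 0 \<le> a \<bullet> x"
    using separating_hyperplane_set_0_inspan[OF \<open>convex M\<close> \<open>M \<noteq> {}\<close>] by blast
  obtain \<mu> u v where a_eq: "a = (\<mu>, u, v)" by (cases a) auto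
  have sep: "0 \<le> \<mu> * t + u \<bullet> (L x - b) + v \<bullet> w"
    if "x \<in> C" "f x - P < t" "\<And>r. h x $ r < w $ r" for t x w
    using a(3)[OF MI[OF that]] by (simp add: a_eq)
  \<comment> \<open>Points of \<open>M\<close> satisfy strict inequalities. Adding a margin
    \<open>e\<close> and letting it tend to 0 gives the non-strict version, which applies at
    \<open>t = f x - P\<close> and \<open>w = h x\<close>.\<close>
  have sep_le: "0 \<le> \<mu> * t + u \<bullet> (L x - b) + v \<bullet> w"
    if x: "x \<in> C" "f x - P \<le> t" "\<And>r. h x $ r \<le> w $ r" for t x w
  proof -
    have "((\<lambda>e. \<mu> * (t + e) + u \<bullet> (L x - b) + v \<bullet> (w + e *\<^sub>R 1)) \<longlongrightarrow>
        \<mu> * (t + 0) + u \<bullet> (L x - b) + v \<bullet> (w + 0 *\<^sub>R 1)) (at_right 0)"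
      by (intro tendsto_intros)
    moreover have "\<forall>\<^sub>F e in at_right 0. 0 \<le> \<mu> * (t + e) + u \<bullet> (L x - b) + v \<bullet> (w + e *\<^sub>R 1)"
      using eventually_at_right_less[of "0::real"]
    proof eventually_elim
      case (elim e)
      have "h x $ r < (w + e *\<^sub>R 1) $ r" for r using x(3)[of r] elim by simp
      with x elim show ?case by (intro sep) auto
    qed
    ultimately show ?thesis
      using tendsto_lowerbound[of _ _ "at_right (0::real)" 0] by fastforce
  qed
  have v: "0 \<le> v $ r" for r
  proof (rule ccontr)
    assume neg: "\<not> 0 \<le> v $ r"
    \<comment> \<open>If \<open>v $ r < 0\<close>, raising \<open>w $ r\<close> at the Slater point
      by \<open>B / - (v $ r)\<close> lowers the expression by \<open>B\<close>, more than the
      absolute value of the remaining terms.\<close>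
    define B where "B = \<bar>\<mu> * (f z - P) + v \<bullet> h z\<bar> + 1"
    have "0 \<le> \<mu> * (f z - P) + u \<bullet> (L z - b) + v \<bullet> (h z + (B / - (v $ r)) *\<^sub>R axis r 1)"
      using zC neg by (intro sep_le) (auto simp: axis_def B_def intro!: divide_nonneg_neg)
    also have "\<dots> = \<mu> * (f z - P) + v \<bullet> h z - B"
      using neg z(2) by (simp add: inner_add_right inner_diff_right inner_axis)
    finally show False unfolding B_def by linarith
  qed
  have "0 \<le> \<mu>"
  proof (rule ccontr)
    assume neg: "\<not> 0 \<le> \<mu>"
    \<comment> \<open>The same argument, now raising \<open>t\<close> by
      \<open>B / - \<mu>\<close>.\<close>
    define B where "B = \<bar>\<mu> * (f z - P) + v \<bullet> h z\<bar> + 1"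
    have "0 \<le> \<mu> * (f z - P + B / - \<mu>) + u \<bullet> (L z - b) + v \<bullet> h z"
      using zC neg by (intro sep_le) (auto simp: B_def intro!: divide_nonneg_neg)
    also have "\<dots> = \<mu> * (f z - P) + v \<bullet> h z - B"
      using neg z(2) by (simp add: algebra_simps)
    finally show False unfolding B_def by linarith
  qed
  moreover have "\<mu> \<noteq> 0"
  proof
    assume \<mu>: "\<mu> = 0"
    \<comment> \<open>At the Slater point only \<open>v \<bullet> h z\<close> is left. It is a sum
      of nonpositive terms, so each term is zero, and \<open>h z $ r < 0\<close> gives
      \<open>v = 0\<close>.\<close>
    have "0 \<le> v \<bullet> h z" using sep_le[OF zC order_refl order_refl] \<mu> z(2) by simp
    moreover have nonneg: "0 \<le> v $ r * - h z $ r" for r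
      using v z(3)[of r] by (intro mult_nonneg_nonneg) simp_all
    ultimately have "(\<Sum>r\<in>UNIV. v $ r * - h z $ r) = 0"
      using sum_nonneg[of UNIV "\<lambda>r. v $ r * - h z $ r"] by (simp add: inner_vec_def sum_negf)
    then have "v $ r * - h z $ r = 0" for r
      using nonneg by (subst (asm) sum_nonneg_eq_0_iff) simp_all
    then have v0: "v = 0" using z(3) by (auto simp: vec_eq_iff less_le)
    \<comment> \<open>What remains says that \<open>u \<bullet> L x\<close> is minimal over
      \<open>C\<close> at \<open>z\<close>, hence constant on \<open>C\<close>. So \<open>a\<close>
      is orthogonal to \<open>M\<close>, thus to \<open>span M\<close>, which contains
      \<open>a\<close> itself.\<close>
    have "u \<bullet> L x = u \<bullet> L z" if "x \<in> C" for x
    proof (rule linear_vanishes_if_nonneg_zero_rel_interior[OF C z(1) _ _ that])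
      show "linear (\<lambda>x. u \<bullet> L x)"
        using L by (auto simp: linear_iff inner_add_right)
      show "u \<bullet> L z \<le> u \<bullet> L x" if "x \<in> C" for x
        using sep_le[OF that order_refl order_refl] \<mu> v0 z(2) by (simp add: inner_diff_right)
    qed
    then have "M \<subseteq> {m. a \<bullet> m = 0}"
      using z(2) \<mu> v0 by (auto simp: M_def a_eq inner_diff_right)
    then have "span M \<subseteq> {m. a \<bullet> m = 0}"
      by (rule span_minimal) (rule subspace_hyperplane)
    then show False using a(1,2) by auto
  qed
  ultimately have \<mu>: "0 < \<mu>" by simp
  show ?thesis
  proof
    \<comment> \<open>Division by \<open>\<mu>\<close> normalises the coefficient of the objective
      to 1.\<close>
    show "0 \<le> (v /\<^sub>R \<mu>) $ r" for r using v \<mu> by simp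
    show "P \<le> f x + (u /\<^sub>R \<mu>) \<bullet> (L x - b) + (v /\<^sub>R \<mu>) \<bullet> h x" if "x \<in> C" for x
      using sep_le[OF that order_refl order_refl] \<mu>
      by (simp add: field_simps)
  qed
qed

section \<open>Vectors of extended reals\<close>

lemma evec_nth [simp]: "evec x $ i = ereal (x $ i)"
  by (simp add: evec_def)

lemma evec_plus: "evec x + evec y = evec (x + y)"
  by (simp add: vec_eq_iff)

lemma evec_minus: "evec x - evec y = evec (x - y)"
  by (simp add: vec_eq_iff)

lemma evec_le_iff: "evec x \<le> evec y \<longleftrightarrow> x \<le> y"
  by (simp add: less_eq_vec_def)

lemma edot_evec: "edot (evec x) (evec y) = ereal (x \<bullet> y)"
  by (simp add: edot_def inner_vec_def)

lemma ematvec_evec: "ematvec K (evec z) = evec (K *v z)"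
  by (simp add: ematvec_def edot_evec vec_eq_iff matrix_vector_mult_def inner_vec_def)

section \<open>Blocks of coordinates\<close>

lemma linear_subvec: "linear (subvec J)"
  by (auto simp: linear_iff subvec_def vec_eq_iff)

lemma subvec_in_coord_space [simp]: "subvec J x \<in> coord_space J"
  by (simp add: subvec_def coord_space_def)

lemma zero_in_coord_space [simp]: "0 \<in> coord_space J"
  by (simp add: coord_space_def)

lemma subvec_coord_space: "x \<in> coord_space J \<Longrightarrow> subvec J x = x"
  by (auto simp: subvec_def coord_space_def vec_eq_iff)

lemma subvec_coord_space_disjoint: "x \<in> coord_space J \<Longrightarrow> J \<inter> J' = {} \<Longrightarrow> subvec J' x = 0"
  by (auto simp: subvec_def coord_space_def vec_eq_iff)

lemma inner_coord_space_subvec: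
  fixes x y :: "real ^ 'n::finite"
  shows "x \<in> coord_space J \<Longrightarrow> x \<bullet> subvec J y = x \<bullet> y"
  by (auto simp: inner_vec_def subvec_def coord_space_def intro!: sum.cong)

lemma inner_subvec_sum:
  fixes I :: "'m::finite \<Rightarrow> 'n::finite set"
  assumes "index_partition I"
  shows "(\<Sum>i\<in>UNIV. subvec (I i) x \<bullet> subvec (I i) y) = x \<bullet> y"
proof -
  have "(\<Sum>i\<in>UNIV. subvec (I i) x \<bullet> subvec (I i) y) = (\<Sum>i\<in>UNIV. \<Sum>j\<in>I i. x $ j * y $ j)"
    by (auto simp: inner_vec_def subvec_def if_distrib sum.If_cases intro!: sum.cong)
  also have "\<dots> = (\<Sum>j\<in>(\<Union>i. I i). x $ j * y $ j)"
    using assms by (subst sum.UNION_disjoint_family) (auto simp: index_partition_def)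
  also have "\<dots> = x \<bullet> y"
    using assms by (simp add: index_partition_def inner_vec_def)
  finally show ?thesis .
qed

section \<open>Gauges and polars\<close>

lemma polar_on_upper: "x \<in> S \<Longrightarrow> g x \<le> 1 \<Longrightarrow> ereal (x \<bullet> y) \<le> polar_on S g y"
  unfolding polar_on_def by (rule Sup_upper) blast

text \<open>The origin is admissible in the supremum and contributes 0.\<close>

lemma polar_on_nonneg:
  assumes "gauge_fun_on S g" "0 \<in> S"
  shows "0 \<le> polar_on S g y"
  using polar_on_upper[of 0 S g y] assms by (simp add: gauge_fun_on_def flip: zero_ereal_def)

text \<open>
  Finiteness of the polar cannot be dropped: if \<open>g x = 0\<close> and \<open>x \<bullet> y > 0\<close>, then the polar is
  \<open>\<infinity>\<close> at \<open>y\<close>, and \<open>\<infinity> * 0 = 0\<close>.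
\<close>

lemma gauge_polar_inequality:
  fixes g :: "'a::real_inner \<Rightarrow> ereal"
  assumes g: "gauge_fun_on S g" and S: "\<And>x c. x \<in> S \<Longrightarrow> c > 0 \<Longrightarrow> c *\<^sub>R x \<in> S"
    and x: "x \<in> S" "g x = ereal \<gamma>" and pol: "polar_on S g y = ereal \<pi>"
  shows "x \<bullet> y \<le> \<pi> * \<gamma>"
proof -
  have "0 \<le> \<gamma>" using g x unfolding gauge_fun_on_def by (metis ereal_less_eq(5))
  \<comment> \<open>Here \<open>t\<close> scales \<open>x\<close> into the unit ball of
    \<open>g\<close>, where the definition of the polar applies.\<close>
  have scaled: "t * (x \<bullet> y) \<le> \<pi>" if "t > 0" "t * \<gamma> \<le> 1" for t
  proof -
    have "g (t *\<^sub>R x) = ereal (t * \<gamma>)"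
      using g x that(1) by (simp add: gauge_fun_on_def)
    then have "ereal ((t *\<^sub>R x) \<bullet> y) \<le> polar_on S g y"
      using that S x(1) by (intro polar_on_upper) (auto simp: one_ereal_def)
    then show ?thesis by (simp add: pol)
  qed
  show ?thesis
  proof (cases "\<gamma> = 0")
    case True
    have "x \<bullet> y \<le> 0"
    proof (rule ccontr)
      assume pos: "\<not> x \<bullet> y \<le> 0"
      \<comment> \<open>With \<open>\<gamma> = 0\<close> every positive \<open>t\<close> is allowed;
        this one makes the scaled product \<open>\<bar>\<pi>\<bar> + 1\<close>, which exceeds
        \<open>\<pi>\<close>.\<close>
      then have "(\<bar>\<pi>\<bar> + 1) / (x \<bullet> y) * (x \<bullet> y) \<le> \<pi>" using True by (intro scaled) auto
      then show False using pos by (simp add: abs_if split: if_splits)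
    qed
    then show ?thesis using True by simp
  next
    case False
    then show ?thesis
      using scaled[of "1 / \<gamma>"] \<open>0 \<le> \<gamma>\<close> by (simp add: field_simps)
  qed
qed

text \<open>Ordinary vector algebra becomes available. Since \<open>real_of_ereal\<close> maps
  \<open>\<infinity>\<close> to 0, the value agrees with the gauge only on
  \<open>vgauge_dom I g\<close>.\<close>

definition real_vgauge ::
    "('m \<Rightarrow> 'n set) \<Rightarrow> ('m \<Rightarrow> real ^ 'n \<Rightarrow> ereal) \<Rightarrow> real ^ 'n \<Rightarrow> real ^ 'm" where
  "real_vgauge I g x = (\<chi> i. real_of_ereal (g i (subvec (I i) x)))"

lemma vector_gaugeD:
  assumes "vector_gauge I g"
  shows "gauge_fun_on (coord_space (I i)) (g i)" "index_partition I"
    "i \<noteq> j \<Longrightarrow> I i \<inter> I j = {}"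
  using assms by (auto simp: vector_gauge_def index_partition_def disjoint_family_on_def)

lemma gauge_eq_real_vgauge:
  assumes vg: "vector_gauge I g" and x: "x \<in> vgauge_dom I g"
  shows "g i (subvec (I i) x) = ereal (real_vgauge I g x $ i)"
proof -
  have "0 \<le> g i (subvec (I i) x)" "g i (subvec (I i) x) < \<infinity>"
    using vector_gaugeD(1)[OF vg, of i] x by (auto simp: gauge_fun_on_def vgauge_dom_def)
  then show ?thesis
    by (cases "g i (subvec (I i) x)") (auto simp: real_vgauge_def)
qed

lemma vgauge_eq_evec:
  assumes "vector_gauge I g" "x \<in> vgauge_dom I g"
  shows "vgauge I g x = evec (real_vgauge I g x)"
  by (simp add: vgauge_def vec_eq_iff gauge_eq_real_vgauge[OF assms])

lemma real_vgauge_nonneg: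
  assumes "vector_gauge I g"
  shows "0 \<le> real_vgauge I g x $ i"
  using vector_gaugeD(1)[OF assms, of i]
  by (auto simp: gauge_fun_on_def real_vgauge_def intro!: real_of_ereal_pos)

lemma real_vgauge_scaleR:
  assumes vg: "vector_gauge I g" and x: "x \<in> vgauge_dom I g" and c: "c > 0"
  shows "c *\<^sub>R x \<in> vgauge_dom I g" "real_vgauge I g (c *\<^sub>R x) = c *\<^sub>R real_vgauge I g x"
proof -
  have *: "g i (subvec (I i) (c *\<^sub>R x)) = ereal (c * real_vgauge I g x $ i)" for i
    using vector_gaugeD(1)[OF vg, of i] c
    by (simp add: gauge_fun_on_def linear_cmul[OF linear_subvec] gauge_eq_real_vgauge[OF vg x])
  show "c *\<^sub>R x \<in> vgauge_dom I g" by (simp add: vgauge_dom_def *)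
  show "real_vgauge I g (c *\<^sub>R x) = c *\<^sub>R real_vgauge I g x"
    unfolding real_vgauge_def[of I g "c *\<^sub>R x"] * by (simp add: vec_eq_iff)
qed

text \<open>The left side stays extended real because its finiteness, and so convexity of the
  domain, is deduced from this bound.\<close>

lemma vgauge_convex_combination:
  assumes vg: "vector_gauge I g" and x: "x \<in> vgauge_dom I g" and y: "y \<in> vgauge_dom I g"
    and t: "0 < t" "t < 1"
  shows "g i (subvec (I i) ((1 - t) *\<^sub>R x + t *\<^sub>R y))
    \<le> ereal ((1 - t) * real_vgauge I g x $ i + t * real_vgauge I g y $ i)"
  using vector_gaugeD(1)[OF vg, of i, unfolded gauge_fun_on_def] t
  by (simp add: linear_cmul[OF linear_subvec] linear_add[OF linear_subvec]
      flip: times_ereal.simps(1) plus_ereal.simps(1)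
        gauge_eq_real_vgauge[OF vg x] gauge_eq_real_vgauge[OF vg y])

lemma convex_on_real_vgauge:
  assumes vg: "vector_gauge I g"
  shows "convex_on (vgauge_dom I g) (\<lambda>x. real_vgauge I g x $ i)"
proof -
  have dom: "(1 - t) *\<^sub>R x + t *\<^sub>R y \<in> vgauge_dom I g"
    if "x \<in> vgauge_dom I g" "y \<in> vgauge_dom I g" "0 < t" "t < 1" for x y t
    unfolding vgauge_dom_def
    by (intro CollectI allI le_less_trans[OF vgauge_convex_combination[OF vg that]]) simp
  show ?thesis
  proof (rule convex_onI)
    show "convex (vgauge_dom I g)"
      unfolding convex_alt
      using dom by (metis add_0 add.right_neutral diff_zero diff_self less_le scaleR_one scaleR_zero_left)
    show "real_vgauge I g ((1 - t) *\<^sub>R x + t *\<^sub>R y) $ i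
        \<le> (1 - t) * real_vgauge I g x $ i + t * real_vgauge I g y $ i"
      if "0 < t" "t < 1" "x \<in> vgauge_dom I g" "y \<in> vgauge_dom I g" for t x y
      using vgauge_convex_combination[OF vg that(3,4,1,2), of i]
      by (simp add: gauge_eq_real_vgauge[OF vg dom[OF that(3,4,1,2)]])
  qed
qed

text \<open>This is the common shape of the objective and of each inequality constraint; signs of
  \<open>d\<close> and \<open>K\<close> enter through \<open>a\<close>.\<close>

lemma convex_on_inner_real_vgauge:
  assumes vg: "vector_gauge I g" and a: "\<And>i. 0 \<le> a $ i"
  shows "convex_on (vgauge_dom I g) (\<lambda>x. e \<bullet> x + \<epsilon> + a \<bullet> real_vgauge I g x)"
proof -
  have C: "convex (vgauge_dom I g)"
    using convex_on_real_vgauge[OF vg] by (rule convex_on_imp_convex)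
  have "convex_on (vgauge_dom I g) (\<lambda>x. \<Sum>i\<in>UNIV. a $ i * real_vgauge I g x $ i)"
    using finite[of UNIV]
  proof induction
    case empty
    show ?case using C by (simp add: convex_on_const)
  next
    case (insert i F)
    then show ?case
      using convex_on_add[OF convex_on_cmul[OF a convex_on_real_vgauge[OF vg]]] by simp
  qed
  moreover have "convex_on (vgauge_dom I g) (\<lambda>x. e \<bullet> x)"
    using C by (auto simp: convex_on_def inner_add_right)
  ultimately have "convex_on (vgauge_dom I g)
      (\<lambda>x. e \<bullet> x + \<epsilon> + (\<Sum>i\<in>UNIV. a $ i * real_vgauge I g x $ i))"
    using C by (intro convex_on_add) (simp_all add: convex_on_const)
  then show ?thesis by (simp add: inner_vec_def)
qed

text \<open>A vector supported on block \<open>i\<close> vanishes on all other blocks, where the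
  gauges are therefore 0. Such vectors localise an inequality on the whole domain to one
  block.\<close>

lemma coord_space_in_vgauge_dom:
  assumes vg: "vector_gauge I g" and x: "x \<in> coord_space (I i)" "g i x < \<infinity>"
  shows "x \<in> vgauge_dom I g"
    "a \<bullet> real_vgauge I g x = a $ i * real_of_ereal (g i x)"
proof -
  have *: "g j (subvec (I j) x) = (if j = i then g i x else 0)" for j
    using x(1) vector_gaugeD(3)[OF vg, of i j] vector_gaugeD(1)[OF vg, of j]
    by (auto simp: subvec_coord_space subvec_coord_space_disjoint gauge_fun_on_def)
  show "x \<in> vgauge_dom I g" using x(2) by (simp add: vgauge_dom_def *)
  show "a \<bullet> real_vgauge I g x = a $ i * real_of_ereal (g i x)"
    by (simp add: inner_vec_def real_vgauge_def * if_distrib cong: if_cong)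
qed

section \<open>Duality\<close>

lemma vpolar_nonneg: "vector_gauge I g \<Longrightarrow> 0 \<le> vpolar I g y $ i"
  using polar_on_nonneg[OF vector_gaugeD(1)] by (simp add: vpolar_def)

text \<open>Testing the inequality with vectors supported on block \<open>i\<close> and lying in the
  unit ball of \<open>g i\<close> bounds every term of the supremum by \<open>q $ i\<close>.\<close>

lemma vpolar_le_evecI:
  assumes vg: "vector_gauge I g" and q: "\<And>i. 0 \<le> q $ i"
    and le: "\<And>x. x \<in> vgauge_dom I g \<Longrightarrow> y \<bullet> x \<le> q \<bullet> real_vgauge I g x"
  shows "vpolar I g y $ i \<le> ereal (q $ i)"
proof -
  have "ereal (x \<bullet> subvec (I i) y) \<le> ereal (q $ i)"
    if x: "x \<in> coord_space (I i)" "g i x \<le> 1" for x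
  proof -
    have "g i x < \<infinity>" using x(2) by auto
    note dom = coord_space_in_vgauge_dom[OF vg x(1) this]
    have "x \<bullet> subvec (I i) y \<le> q $ i * real_of_ereal (g i x)"
      using le[OF dom(1)] by (simp add: inner_coord_space_subvec[OF x(1)] dom(2) inner_commute)
    also have "\<dots> \<le> q $ i * 1"
      using x(2) q by (intro mult_left_mono) (cases "g i x"; auto simp: one_ereal_def)+
    finally show ?thesis by simp
  qed
  then show ?thesis by (auto simp: vpolar_def polar_on_def intro!: Sup_least)
qed

text \<open>The blockwise gauge-polar inequalities are summed over the partition.\<close>

lemma inner_le_vpolar_vgauge:
  assumes vg: "vector_gauge I g" and x: "x \<in> vgauge_dom I g" and y: "vpolar I g y = evec \<pi>"
  shows "y \<bullet> x \<le> \<pi> \<bullet> real_vgauge I g x"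
proof -
  have "subvec (I i) x \<bullet> subvec (I i) y \<le> \<pi> $ i * real_vgauge I g x $ i" for i
  proof (rule gauge_polar_inequality[OF vector_gaugeD(1)[OF vg]])
    show "c *\<^sub>R z \<in> coord_space (I i)" if "z \<in> coord_space (I i)" for z and c :: real
      using that by (simp add: coord_space_def)
    show "polar_on (coord_space (I i)) (g i) (subvec (I i) y) = ereal (\<pi> $ i)"
      using y by (simp add: vpolar_def vec_eq_iff)
  qed (simp_all add: gauge_eq_real_vgauge[OF vg x])
  then have "(\<Sum>i\<in>UNIV. subvec (I i) x \<bullet> subvec (I i) y) \<le> \<pi> \<bullet> real_vgauge I g x"
    unfolding inner_vec_def[of \<pi>] inner_real_def by (intro sum_mono)
  then show ?thesis
    by (simp add: inner_subvec_sum[OF vector_gaugeD(2)[OF vg]] inner_commute[of y])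
qed

section \<open>Feasibility in terms of real vectors\<close>

lemma primal_feasible_iff:
  assumes "vector_gauge I g"
  shows "primal_feasible I g A b H K p x \<longleftrightarrow>
    x \<in> vgauge_dom I g \<and> A *v x = b \<and> (\<forall>r. (H *v x + K *v real_vgauge I g x - p) $ r \<le> 0)"
  using vgauge_eq_evec[OF assms]
  by (auto simp: primal_feasible_def ematvec_evec evec_plus evec_le_iff less_eq_vec_def
      simp del: vector_add_component)

lemma dual_feasible_iff:
  assumes "vector_gauge I g"
  shows "dual_feasible I g c d A H K u v \<longleftrightarrow> 0 \<le> v \<and>
    (\<forall>i. vpolar I g (transpose A *v u - transpose H *v v - c) $ i
       \<le> ereal ((d + transpose K *v v) $ i))"
  by (auto simp: dual_feasible_def less_eq_vec_def ereal_minus_le_iff add.commute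
      split: if_splits)

text \<open>Each polar value lies between 0 and a real bound.\<close>

lemma dual_feasible_vpolar_finite:
  assumes "vector_gauge I g" and "dual_feasible I g c d A H K u v"
  obtains \<pi> where "vpolar I g (transpose A *v u - transpose H *v v - c) = evec \<pi>"
    "\<And>i. \<pi> $ i \<le> (d + transpose K *v v) $ i"
proof
  let ?p = "vpolar I g (transpose A *v u - transpose H *v v - c)"
  have le: "?p $ i \<le> ereal ((d + transpose K *v v) $ i)" for i
    using assms dual_feasible_iff by metis
  have eq: "?p $ i = ereal (real_of_ereal (?p $ i))" for i
    using le[of i] vpolar_nonneg[OF assms(1), of _ i] by (intro ereal_real'[symmetric]) auto
  then show "?p = evec (\<chi> i. real_of_ereal (?p $ i))" by (simp add: vec_eq_iff)
  show "(\<chi> i. real_of_ereal (?p $ i)) $ i \<le> (d + transpose K *v v) $ i" for i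
    using le[of i] by (subst (asm) eq) simp
qed

text \<open>\<open>P\<close> is any lower bound of the primal values; the multipliers for it form a
  dual feasible point whose value is at least \<open>P\<close>.\<close>

theorem gauge_strong_duality:
  fixes A :: "real ^ 'n::finite ^ 'k::finite" and H :: "real ^ 'n ^ 'l::finite"
    and K :: "real ^ 'm::finite ^ 'l"
  assumes vg: "vector_gauge I g" and d: "\<forall>i. 0 \<le> d $ i" and K: "\<forall>r i. 0 \<le> K $ r $ i"
    and sl: "slater I g A b H K p"
    and P: "\<And>x. primal_feasible I g A b H K p x \<Longrightarrow> P \<le> c \<bullet> x + d \<bullet> real_vgauge I g x"
  obtains u v where "dual_feasible I g c d A H K u v" "P \<le> b \<bullet> u - p \<bullet> v"
proof -
  let ?G = "real_vgauge I g" and ?D = "vgauge_dom I g"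
  let ?h = "\<lambda>x. H *v x + K *v ?G x - p"
  obtain z where z: "z \<in> rel_interior ?D" "A *v z = b"
      "\<And>r. (evec (H *v z) + ematvec K (vgauge I g z)) $ r < evec p $ r"
    using sl by (auto simp: slater_def)
  have zD: "z \<in> ?D" using z(1) rel_interior_subset by blast
  have hz: "?h z $ r < 0" for r
    using z(3)[of r] by (simp add: vgauge_eq_evec[OF vg zD] ematvec_evec)
  have h: "convex_on ?D (\<lambda>x. ?h x $ r)" for r
    using convex_on_inner_real_vgauge[OF vg, of "K $ r" "H $ r" "- p $ r"] K
    by (simp add: matrix_vector_mul_component algebra_simps)
  have f: "convex_on ?D (\<lambda>x. c \<bullet> x + d \<bullet> ?G x)"
    using convex_on_inner_real_vgauge[OF vg, of d c 0] d by simp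
  have opt: "P \<le> c \<bullet> x + d \<bullet> ?G x"
    if "x \<in> ?D" "A *v x = b" "\<And>r. ?h x $ r \<le> 0" for x
    using P that primal_feasible_iff[OF vg] by blast
  obtain u v where v: "\<And>r. 0 \<le> v $ r"
    and low: "\<And>x. x \<in> ?D \<Longrightarrow> P \<le> c \<bullet> x + d \<bullet> ?G x + u \<bullet> (A *v x - b) + v \<bullet> ?h x"
    using slater_lagrange_multipliers[OF f h matrix_vector_mul_linear z(1,2) hz opt] by blast
  \<comment> \<open>The equality multiplier enters the Lagrangian with the opposite sign, so the
    dual variable is \<open>- u\<close>.\<close>
  let ?y = "transpose A *v (- u) - transpose H *v v - c"
  let ?q = "d + transpose K *v v"
  \<comment> \<open>The Lagrangian splits into a positively homogeneous part and the dual
    objective.\<close>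
  have low': "P \<le> (?q \<bullet> ?G x - ?y \<bullet> x) + (b \<bullet> (- u) - p \<bullet> v)" if "x \<in> ?D" for x
  proof -
    have "c \<bullet> x + d \<bullet> ?G x + u \<bullet> (A *v x - b) + v \<bullet> ?h x
        = (?q \<bullet> ?G x - ?y \<bullet> x) + (b \<bullet> (- u) - p \<bullet> v)"
      by (simp add: inner_diff_left inner_diff_right inner_add_left inner_add_right
          dot_lmul_matrix inner_commute[of b] inner_commute[of p])
    then show ?thesis using low[OF that] by simp
  qed
  have zero: "0 \<in> ?D" "?G 0 = 0"
    using vector_gaugeD(1)[OF vg]
    by (auto simp: vgauge_dom_def real_vgauge_def vec_eq_iff linear_0[OF linear_subvec]
        gauge_fun_on_def)
  have hom: "?y \<bullet> x \<le> ?q \<bullet> ?G x" if x: "x \<in> ?D" for x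
  proof (rule ccontr)
    assume "\<not> ?y \<bullet> x \<le> ?q \<bullet> ?G x"
    then have neg: "?y \<bullet> x - ?q \<bullet> ?G x > 0" by simp
    \<comment> \<open>If the homogeneous part is negative at \<open>x\<close>, then at
      \<open>B *\<^sub>R x\<close> it equals minus the numerator of \<open>B\<close>, which pushes
      the Lagrangian below \<open>P\<close>.\<close>
    define B where "B = (\<bar>b \<bullet> (- u) - p \<bullet> v - P\<bar> + 1) / (?y \<bullet> x - ?q \<bullet> ?G x)"
    have B: "B > 0" using neg by (simp add: B_def add_nonneg_pos)
    have "P \<le> - (B * (?y \<bullet> x - ?q \<bullet> ?G x)) + (b \<bullet> (- u) - p \<bullet> v)"
      using low'[OF real_vgauge_scaleR(1)[OF vg x B]]
      unfolding real_vgauge_scaleR(2)[OF vg x B] inner_scaleR_right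
      by (simp only: right_diff_distrib minus_diff_eq)
    also have "B * (?y \<bullet> x - ?q \<bullet> ?G x) = \<bar>b \<bullet> (- u) - p \<bullet> v - P\<bar> + 1"
      using neg unfolding B_def by (intro nonzero_eq_divide_eq[THEN iffD1]) simp_all
    finally show False by linarith
  qed
  show ?thesis
  proof
    have "0 \<le> ?q $ i" for i
      using d v K
      by (auto simp: matrix_vector_mult_def transpose_def intro!: add_nonneg_nonneg sum_nonneg)
    then show "dual_feasible I g c d A H K (- u) v"
      unfolding dual_feasible_iff[OF vg] using vpolar_le_evecI[OF vg _ hom] v
      by (auto simp: less_eq_vec_def)
    \<comment> \<open>At the origin the homogeneous part vanishes.\<close>
    show "P \<le> b \<bullet> (- u) - p \<bullet> v" using low'[OF zero(1)] zero(2) by simp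
  qed
qed

section \<open>Complementary slackness from the vanishing duality gap\<close>

theorem theorem5:
  fixes I :: "'m::finite \<Rightarrow> 'n::finite set"
    and g :: "'m \<Rightarrow> real ^ 'n \<Rightarrow> ereal"
    and c :: "real ^ 'n" and d :: "real ^ 'm"
    and b :: "real ^ 'k::finite" and p :: "real ^ 'l::finite"
    and A :: "real ^ 'n ^ 'k" and H :: "real ^ 'n ^ 'l" and K :: "real ^ 'm ^ 'l"
    and xs :: "real ^ 'n" and us :: "real ^ 'k" and vs :: "real ^ 'l"
  assumes "vector_gauge I g"
    and "\<forall>i. 0 \<le> d $ i"
    and "\<forall>r i. 0 \<le> K $ r $ i"
    and "slater I g A b H K p"
    and "primal_optimal I g c d A b H K p xs"
    and "dual_optimal I g c d A b H K p us vs"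
  shows "(evec (H *v xs) + ematvec K (vgauge I g xs) \<le> evec p \<and>
          A *v xs = b \<and> xs \<in> vgauge_dom I g) \<and>
         (vpolar I g (transpose A *v us - transpose H *v vs - c) - evec (transpose K *v vs)
            \<le> evec d \<and> 0 \<le> vs) \<and>
         (\<forall>i. (evec d + evec (transpose K *v vs)
                 - vpolar I g (transpose A *v us - transpose H *v vs - c)) $ i
               * g i (subvec (I i) xs) = 0) \<and>
         (\<forall>r. (evec p - evec (H *v xs) - ematvec K (vgauge I g xs)) $ r * ereal (vs $ r) = 0) \<and>
         edot (vpolar I g (transpose A *v us - transpose H *v vs - c)) (vgauge I g xs)
           = ereal ((transpose A *v us - transpose H *v vs - c) \<bullet> xs)"
proof -
  let ?G = "real_vgauge I g xs"
  let ?y = "transpose A *v us - transpose H *v vs - c"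
  let ?q = "d + transpose K *v vs"
  let ?s = "p - H *v xs - K *v ?G"
  note vg = assms(1)
  have pf: "primal_feasible I g A b H K p xs"
    and pmin: "\<And>x. primal_feasible I g A b H K p x \<Longrightarrow>
      primal_objective I g c d xs \<le> primal_objective I g c d x"
    using assms(5) by (auto simp: primal_optimal_def is_arg_min_def not_less)
  have df: "dual_feasible I g c d A H K us vs"
    and dmax: "\<And>u v. dual_feasible I g c d A H K u v \<Longrightarrow> b \<bullet> u - p \<bullet> v \<le> b \<bullet> us - p \<bullet> vs"
    using assms(6) by (auto simp: dual_optimal_def is_arg_max_def not_less)
  have dom: "xs \<in> vgauge_dom I g" and Ax: "A *v xs = b" and slack: "\<And>r. 0 \<le> ?s $ r"
    using pf[unfolded primal_feasible_iff[OF vg]] by (auto simp: algebra_simps)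
  have vs: "\<And>r. 0 \<le> vs $ r"
    using df by (simp add: dual_feasible_def less_eq_vec_def)
  obtain \<pi> where \<pi>: "vpolar I g ?y = evec \<pi>" "\<And>i. \<pi> $ i \<le> ?q $ i"
    using dual_feasible_vpolar_finite[OF vg df] by blast
  have obj: "primal_objective I g c d x = ereal (c \<bullet> x + d \<bullet> real_vgauge I g x)"
    if "primal_feasible I g A b H K p x" for x
    using that
    by (simp add: primal_objective_def primal_feasible_def vgauge_eq_evec[OF vg] edot_evec)
  have "c \<bullet> xs + d \<bullet> ?G \<le> c \<bullet> x + d \<bullet> real_vgauge I g x"
    if "primal_feasible I g A b H K p x" for x
    using pmin[OF that] by (simp add: obj that pf)
  \<comment> \<open>The lower bound \<open>P\<close> is taken to be the primal optimal
    value.\<close>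
  then obtain u v where "dual_feasible I g c d A H K u v" "c \<bullet> xs + d \<bullet> ?G \<le> b \<bullet> u - p \<bullet> v"
    by (rule gauge_strong_duality[OF vg assms(2-4)])
  then have strong: "c \<bullet> xs + d \<bullet> ?G \<le> b \<bullet> us - p \<bullet> vs"
    using dmax by fastforce
  \<comment> \<open>The duality gap is the sum of the slack in the gauge-polar inequality, the dual
    slack paired with the gauges, and the primal slack paired with \<open>vs\<close>. All three are
    nonnegative and the gap is at most 0, so each is zero.\<close>
  have gap: "(c \<bullet> xs + d \<bullet> ?G) - (b \<bullet> us - p \<bullet> vs)
      = (\<pi> \<bullet> ?G - ?y \<bullet> xs) + (?q - \<pi>) \<bullet> ?G + ?s \<bullet> vs"
    by (simp add: inner_diff_left inner_diff_right inner_add_left dot_lmul_matrix Ax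
        inner_commute[of _ vs] inner_commute[of b])
  have polar: "0 \<le> \<pi> \<bullet> ?G - ?y \<bullet> xs"
    using inner_le_vpolar_vgauge[OF vg dom \<pi>(1)] by simp
  have terms: "0 \<le> (?q - \<pi>) $ i * ?G $ i" "0 \<le> ?s $ r * vs $ r" for i r
    using \<pi>(2)[of i] by (intro mult_nonneg_nonneg real_vgauge_nonneg vg slack vs; simp)+
  then have "0 \<le> (?q - \<pi>) \<bullet> ?G" "0 \<le> ?s \<bullet> vs"
    by (simp_all only: inner_vec_def inner_real_def sum_nonneg)
  with strong gap polar have eqs: "\<pi> \<bullet> ?G = ?y \<bullet> xs" "(?q - \<pi>) \<bullet> ?G = 0" "?s \<bullet> vs = 0"
    by linarith+
  \<comment> \<open>A vanishing sum of nonnegative terms vanishes termwise.\<close>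
  have iii: "(?q - \<pi>) $ i * ?G $ i = 0" for i
    using eqs(2) terms(1) sum_nonneg_eq_0_iff[of UNIV "\<lambda>i. (?q - \<pi>) $ i * ?G $ i"]
    by (simp only: inner_vec_def inner_real_def) auto
  have iv: "?s $ r * vs $ r = 0" for r
    using eqs(3) terms(2) sum_nonneg_eq_0_iff[of UNIV "\<lambda>r. ?s $ r * vs $ r"]
    by (simp only: inner_vec_def inner_real_def) auto
  show ?thesis
    using pf df iii iv eqs(1)
    unfolding primal_feasible_def dual_feasible_def \<pi>(1) vgauge_eq_evec[OF vg dom]
      gauge_eq_real_vgauge[OF vg dom] ematvec_evec evec_plus evec_minus edot_evec evec_nth
    by (simp only: times_ereal.simps(1) zero_ereal_def) simp
qed

end
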